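(* Let $H\in(0,1/2)$, $T>0$, and let $g\in AC([0,T])$, $g(t)=\int_0^tg'(s)\,ds$, with $g'\in L_2([0,T])$. Let $x$ be the unique $L_2([0,T])$-solution of $$C_1^{-2}t^{1/2-H}\left(I_{T^-}^{1/2-H}\left(\cdot^{2H-1}I_0^{1/2-H}(\cdot^{1/2-H}x)\right)\right)(t)+x(t)=g'(t),\qquad t\in[0,T].$$ Then $x$ is the unique solution $g_B'=x$ of the minimization problem $$\min_{g_B'\in L_2([0,T])}\int_0^T\left((g_W'(t))^2+(h(t))^2\right)dt,$$ where $g_W'=g'-g_B'$ and $h=K_0^{H,*}g_B'$.
   Context: Riemann–Liouville fractional integrals of order $\alpha>0$ on $[0,T]$: $(I_0^\alpha\varphi)(t)=\frac1{\Gamma(\alpha)}\int_0^t(t-z)^{\alpha-1}\varphi(z)dz$ and $(I_{T^-}^\alpha\varphi)(t)=\frac1{\Gamma(\alpha)}\int_t^T(z-t)^{\alpha-1}\varphi(z)dz$. The dot denotes the integration variable. $C_1=\left(\frac{2H\Gamma(H+1/2)\Gamma(3/2-H)}{\Gamma(2-2H)}\right)^{1/2}$ and $(K^{H,*}_0\varphi)(t)=C_1^{-1}t^{H-1/2}\left(I_0^{1/2-H}(\cdot^{1/2-H}\varphi)\right)(t)$, which maps $L_2([0,T])$ into itself. Equations between elements of $L_2([0,T])$, and uniqueness, are understood almost everywhere. *)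

theory Defs
  imports "HOL-Analysis.Analysis"
begin

definition abs_cont_on :: "real \<Rightarrow> real \<Rightarrow> (real \<Rightarrow> real) \<Rightarrow> bool" where
  "abs_cont_on a b f \<longleftrightarrow>
     (\<forall>\<epsilon>>0. \<exists>\<delta>>0. \<forall>I :: (real \<times> real) set.
        finite I \<and> (\<forall>(u, v) \<in> I. a \<le> u \<and> u < v \<and> v \<le> b) \<and>
        disjoint_family_on (\<lambda>(u, v). {u<..<v}) I \<and> (\<Sum>(u, v)\<in>I. v - u) < \<delta>
        \<longrightarrow> (\<Sum>(u, v)\<in>I. \<bar>f v - f u\<bar>) < \<epsilon>)"

text \<open>Elements of \<open>L\<^sub>2([0,T])\<close> are represented by total functions; only their values on
  \<open>[0,T]\<close> matter, and identification up to null sets is made explicit wherever it is needed.\<close>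

definition L2_on :: "real \<Rightarrow> (real \<Rightarrow> real) set" where
  "L2_on T = {f. f \<in> borel_measurable (lebesgue_on {0..T}) \<and>
                 integrable (lebesgue_on {0..T}) (\<lambda>t. (f t)\<^sup>2)}"

definition unique_in_L2 :: "real \<Rightarrow> ((real \<Rightarrow> real) \<Rightarrow> bool) \<Rightarrow> (real \<Rightarrow> real) \<Rightarrow> bool" where
  "unique_in_L2 T P x \<longleftrightarrow> x \<in> L2_on T \<and> P x \<and>
     (\<forall>y \<in> L2_on T. P y \<longrightarrow> (AE t in lebesgue_on {0..T}. y t = x t))"

text \<open>The Lebesgue integral is \<open>0\<close> for non-integrable integrands. For the functions these operators
  are applied to below, the integrand is integrable for almost every \<open>t\<close> in \<open>[0,T]\<close>,
  so this convention has no effect. Likewise \<open>0 powr a = 0\<close> only matters on null sets.\<close>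

definition RL_left :: "real \<Rightarrow> (real \<Rightarrow> real) \<Rightarrow> real \<Rightarrow> real" where
  "RL_left \<alpha> \<phi> t =
     1 / Gamma \<alpha> * (\<integral>z. (t - z) powr (\<alpha> - 1) * \<phi> z \<partial>lebesgue_on {0..t})"

definition RL_right :: "real \<Rightarrow> real \<Rightarrow> (real \<Rightarrow> real) \<Rightarrow> real \<Rightarrow> real" where
  "RL_right T \<alpha> \<phi> t =
     1 / Gamma \<alpha> * (\<integral>z. (z - t) powr (\<alpha> - 1) * \<phi> z \<partial>lebesgue_on {t..T})"

definition C1 :: "real \<Rightarrow> real" where
  "C1 H = sqrt (2 * H * Gamma (H + 1/2) * Gamma (3/2 - H) / Gamma (2 - 2 * H))"

definition K_star :: "real \<Rightarrow> (real \<Rightarrow> real) \<Rightarrow> real \<Rightarrow> real" where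
  "K_star H \<phi> t =
     inverse (C1 H) * t powr (H - 1/2) * RL_left (1/2 - H) (\<lambda>z. z powr (1/2 - H) * \<phi> z) t"

definition solves_eq :: "real \<Rightarrow> real \<Rightarrow> (real \<Rightarrow> real) \<Rightarrow> (real \<Rightarrow> real) \<Rightarrow> bool" where
  "solves_eq H T g' x \<longleftrightarrow>
     (AE t in lebesgue_on {0..T}.
        inverse ((C1 H)\<^sup>2) * t powr (1/2 - H) *
          RL_right T (1/2 - H)
            (\<lambda>z. z powr (2 * H - 1) * RL_left (1/2 - H) (\<lambda>s. s powr (1/2 - H) * x s) z) t
        + x t = g' t)"

text \<open>The integrand is integrable for every \<open>gB' \<in> L2_on T\<close>, because
  \<open>K_star H\<close> maps \<open>L2_on T\<close> into itself.\<close>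

definition energy :: "real \<Rightarrow> real \<Rightarrow> (real \<Rightarrow> real) \<Rightarrow> (real \<Rightarrow> real) \<Rightarrow> real" where
  "energy H T g' gB' =
     (let gW' = (\<lambda>t. g' t - gB' t); h = K_star H gB'
      in \<integral>t. (gW' t)\<^sup>2 + (h t)\<^sup>2 \<partial>lebesgue_on {0..T})"

end

theory Submission
  imports Defs
begin

text \<open>Write \<open>K\<close> for \<open>K\<^sub>0\<^sup>H\<^sup>,\<^sup>*\<close> as an operator on \<open>L\<^sub>2([0,T])\<close>. Its kernel is bounded by a
  multiple of \<open>(t - z)\<^sub>+\<close> to the power \<open>-1/2 - H\<close>, whose row and column integrals are bounded, so \<open>K\<close> is
  bounded by Schur's test, and by Fubini its adjoint \<open>K'\<close> is the integral operator with the transposed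
  kernel. The integral equation reads \<open>K' K x + x = g'\<close>. The operator \<open>K' K + 1\<close> is bounded and
  coercive, hence invertible, and expanding the square shows that the energy of \<open>u\<close> exceeds the
  energy of the solution \<open>x\<close> by exactly \<open>\<parallel>u - x\<parallel>\<^sup>2 + \<parallel>K (u - x)\<parallel>\<^sup>2\<close>.\<close>

section \<open>Square integrable functions\<close>

text \<open>The setting is an arbitrary measure, so that the operator theory stays independent of
  the interval; \<open>L2_on_eq_sq_int\<close> links it to \<open>L2_on\<close>.\<close>

definition sq_int :: "'a measure \<Rightarrow> ('a \<Rightarrow> real) set" where
  "sq_int M = {f \<in> borel_measurable M. integrable M (\<lambda>x. (f x)\<^sup>2)}"

lemma sq_intD [dest]:
  assumes "f \<in> sq_int M"
  shows "f \<in> borel_measurable M" "integrable M (\<lambda>x. (f x)\<^sup>2)"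
  using assms by (auto simp: sq_int_def)

text \<open>The factor 1/2 of the usual inequality is given away: the bound only has to dominate
  products by integrable or summable terms.\<close>

lemma abs_mult_le_sum_squares: "\<bar>a * b\<bar> \<le> a\<^sup>2 + b\<^sup>2" for a b :: real
proof -
  have "2 * (\<bar>a\<bar> * \<bar>b\<bar>) \<le> a\<^sup>2 + b\<^sup>2"
    using sum_squares_bound[of "\<bar>a\<bar>" "\<bar>b\<bar>"] by (simp add: mult.assoc)
  moreover have "0 \<le> \<bar>a\<bar> * \<bar>b\<bar>" by simp
  ultimately show ?thesis unfolding abs_mult by linarith
qed

lemma sq_int_mult_integrable:
  assumes "f \<in> sq_int M" "g \<in> sq_int M"
  shows "integrable M (\<lambda>x. f x * g x)"
proof (rule Bochner_Integration.integrable_bound)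
  show "integrable M (\<lambda>x. (f x)\<^sup>2 + (g x)\<^sup>2)"
    using assms by (intro Bochner_Integration.integrable_add sq_intD)
  show "(\<lambda>x. f x * g x) \<in> borel_measurable M"
    using assms by (intro borel_measurable_times sq_intD)
  show "AE x in M. norm (f x * g x) \<le> norm ((f x)\<^sup>2 + (g x)\<^sup>2)"
    using abs_mult_le_sum_squares by simp
qed

lemma sq_int_cmult [intro]:
  assumes "f \<in> sq_int M"
  shows "(\<lambda>x. c * f x) \<in> sq_int M"
  using assms by (auto simp: sq_int_def power_mult_distrib)

lemma sq_int_add [intro]:
  assumes "f \<in> sq_int M" "g \<in> sq_int M"
  shows "(\<lambda>x. f x + g x) \<in> sq_int M"
  using assms sq_int_mult_integrable[OF assms]
  by (auto simp: sq_int_def power2_sum mult.assoc)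

lemma sq_int_diff [intro]:
  assumes "f \<in> sq_int M" "g \<in> sq_int M"
  shows "(\<lambda>x. f x - g x) \<in> sq_int M"
  using sq_int_add[OF assms(1) sq_int_cmult[OF assms(2), of "-1"]] by simp

lemma sq_int_zero [simp]: "(\<lambda>x. 0) \<in> sq_int M"
  by (simp add: sq_int_def)

section \<open>Squared norms: vanishing and expansion\<close>

lemma integral_sq_eq_0_AE:
  assumes "f \<in> sq_int M" "(\<integral>x. (f x)\<^sup>2 \<partial>M) \<le> 0"
  shows "AE x in M. f x = 0"
proof -
  have "(\<integral>x. (f x)\<^sup>2 \<partial>M) = 0"
    using assms(2) by (intro antisym Bochner_Integration.integral_nonneg) auto
  then show ?thesis
    using assms(1) by (subst (asm) integral_nonneg_eq_0_iff_AE) auto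
qed

lemma integral_sq_combination:
  assumes "f \<in> sq_int M" "g \<in> sq_int M"
  shows "(\<integral>x. (f x + c * g x)\<^sup>2 \<partial>M)
    = (\<integral>x. (f x)\<^sup>2 \<partial>M) + 2 * c * (\<integral>x. g x * f x \<partial>M) + c\<^sup>2 * (\<integral>x. (g x)\<^sup>2 \<partial>M)"
proof -
  have [simp]: "integrable M (\<lambda>x. (f x)\<^sup>2)" "integrable M (\<lambda>x. (g x)\<^sup>2)" "integrable M (\<lambda>x. g x * f x)"
    using assms by (auto intro: sq_int_mult_integrable)
  have "(\<lambda>x. (f x + c * g x)\<^sup>2) = (\<lambda>x. (f x)\<^sup>2 + 2 * c * (g x * f x) + c\<^sup>2 * (g x)\<^sup>2)"
    by (auto simp: fun_eq_iff power2_eq_square algebra_simps)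
  then show ?thesis by simp
qed

text \<open>Parallelogram law: the expansions of the squared norm for c = 1 and c = -1 add up to the
  right-hand side, and the second is nonnegative.\<close>

lemma integral_sq_add_le:
  assumes "f \<in> sq_int M" "g \<in> sq_int M"
  shows "(\<integral>x. (f x + g x)\<^sup>2 \<partial>M) \<le> 2 * (\<integral>x. (f x)\<^sup>2 \<partial>M) + 2 * (\<integral>x. (g x)\<^sup>2 \<partial>M)"
proof -
  have "0 \<le> (\<integral>x. (f x + (-1) * g x)\<^sup>2 \<partial>M)"
    by (intro Bochner_Integration.integral_nonneg) auto
  then show ?thesis
    using integral_sq_combination[OF assms, of 1] integral_sq_combination[OF assms, of "-1"]
    unfolding mult_1 mult_1_right one_power2 power2_minus by linarith
qed

text \<open>With \<open>s\<^sup>4 = q\<close> the weighted squares \<open>(u\<^sub>n\<^sub>+\<^sub>1 - u\<^sub>n)\<^sup>2 / s\<^sup>2\<^sup>n\<close> still have summable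
  integrals, and Cauchy--Schwarz against \<open>\<Sum>s\<^sup>2\<^sup>n\<close> turns this into pointwise convergence almost
  everywhere together with an integrable majorant.\<close>

lemma sq_int_geometric_limit:
  fixes u :: "nat \<Rightarrow> 'a \<Rightarrow> real"
  assumes u: "\<And>n. u n \<in> sq_int M"
    and inc: "\<And>n. (\<integral>x. (u (Suc n) x - u n x)\<^sup>2 \<partial>M) \<le> C * q ^ n"
    and q: "0 < q" "q < 1"
  shows "\<exists>v\<in>sq_int M. (\<lambda>n. \<integral>x. (v x - u n x)\<^sup>2 \<partial>M) \<longlonglongrightarrow> 0"
proof -
  define s where "s = sqrt (sqrt q)"
  have s: "0 < s" "s < 1" "s ^ 4 = q"
  proof -
    show "0 < s" "s < 1" using q by (auto simp: s_def)
    have "s ^ 4 = (s\<^sup>2)\<^sup>2" by simp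
    also have "s\<^sup>2 = sqrt q" using q by (simp add: s_def)
    also have "(sqrt q)\<^sup>2 = q" using q by simp
    finally show "s ^ 4 = q" .
  qed
  have s2: "0 < s\<^sup>2" "s\<^sup>2 < 1" using s by (auto simp: power_less_one_iff)
  define d where "d n x = u (Suc n) x - u n x" for n x
  have d: "d n \<in> sq_int M" for n
    unfolding d_def using u by auto
  define w where "w n x = (d n x)\<^sup>2 / s ^ (2 * n)" for n x
  have w_int: "integrable M (w n)" for n
    unfolding w_def using d by (intro integrable_divide) auto
  have w_nonneg: "0 \<le> w n x" for n x
    unfolding w_def using s by simp
  \<comment> \<open>Since q = s^4, half of the decay of the integrals pays for the weight
    \<open>s ^ (2 * n)\<close> and the other half keeps them summable.\<close>
  have w_le: "(\<integral>x. w n x \<partial>M) \<le> C * (s\<^sup>2) ^ n" for n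
  proof -
    have "(\<integral>x. w n x \<partial>M) = (\<integral>x. (d n x)\<^sup>2 \<partial>M) / s ^ (2 * n)"
      unfolding w_def by simp
    also have "\<dots> \<le> C * q ^ n / s ^ (2 * n)"
      using inc[of n] s by (intro divide_right_mono) (auto simp: d_def)
    also have "q ^ n = (s\<^sup>2) ^ n * s ^ (2 * n)"
      unfolding s(3)[symmetric] power_mult[symmetric] power_add[symmetric] by simp
    also have "C * ((s\<^sup>2) ^ n * s ^ (2 * n)) / s ^ (2 * n) = C * (s\<^sup>2) ^ n"
      using s by simp
    finally show ?thesis .
  qed
  have sum_w: "summable (\<lambda>n. \<integral>x. w n x \<partial>M)"
  proof (rule summable_comparison_test')
    show "summable (\<lambda>n. C * (s\<^sup>2) ^ n)"
      using s2 by (intro summable_mult summable_geometric) auto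
    show "norm (\<integral>x. w n x \<partial>M) \<le> C * (s\<^sup>2) ^ n" if "n \<ge> 0" for n
      using w_le[of n] w_nonneg by (simp add: Bochner_Integration.integral_nonneg)
  qed
  \<comment> \<open>Sum and integral of nonnegative functions commute in the extended reals, and a
    function with finite integral is finite almost everywhere.\<close>
  have AE_w: "AE x in M. summable (\<lambda>n. w n x)"
  proof -
    have "(\<integral>\<^sup>+x. (\<Sum>n. ennreal (w n x)) \<partial>M) = (\<Sum>n. \<integral>\<^sup>+x. ennreal (w n x) \<partial>M)"
      using w_int by (intro nn_integral_suminf) auto
    also have "\<dots> = (\<Sum>n. ennreal (\<integral>x. w n x \<partial>M))"
      using w_int w_nonneg by (simp add: nn_integral_eq_integral)
    also have "\<dots> \<noteq> \<infinity>"
      using sum_w w_nonneg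
      by (simp add: suminf_ennreal2 Bochner_Integration.integral_nonneg)
    finally have "AE x in M. (\<Sum>n. ennreal (w n x)) \<noteq> \<infinity>"
      using w_int by (intro nn_integral_PInf_AE) auto
    then show ?thesis
      by (rule AE_mp) (auto intro!: AE_I2 summable_suminf_not_top w_nonneg)
  qed
  define W where "W x = (\<Sum>n. w n x)" for x
  have W_int: "integrable M W"
    unfolding W_def using w_int AE_w sum_w w_nonneg by (intro integrable_suminf) auto
  \<comment> \<open>\<open>lim\<close> is a total operator, so \<open>v\<close> is measurable on the
    whole space. Divergence is confined to a null set, so the values there do not matter.\<close>
  define v where "v x = lim (\<lambda>n. u n x)" for x
  have [measurable]: "u n \<in> borel_measurable M" for n
    using u by auto
  have v_meas [measurable]: "v \<in> borel_measurable M"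
    unfolding v_def by measurable
  have bound: "(v x - u m x)\<^sup>2 \<le> (s\<^sup>2) ^ m / (1 - s\<^sup>2) * W x" if sw: "summable (\<lambda>n. w n x)" for x m
  proof -
    \<comment> \<open>Writing |d_n| as s^n times |d_n| / s^n bounds it by a geometric term plus w_n,
      so the increments are absolutely summable wherever the w_n are.\<close>
    have "summable (\<lambda>n. d n x)"
    proof (rule summable_comparison_test')
      show "summable (\<lambda>n. (s\<^sup>2) ^ n + w n x)"
        using s2 sw by (intro summable_add summable_geometric) auto
      fix n
      have "\<bar>d n x\<bar> = \<bar>s ^ n * (d n x / s ^ n)\<bar>"
        using s by simp
      also have "\<dots> \<le> (s ^ n)\<^sup>2 + (d n x / s ^ n)\<^sup>2"
        by (rule abs_mult_le_sum_squares)
      also have "\<dots> = (s\<^sup>2) ^ n + w n x"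
        by (simp add: w_def power_divide power_mult[symmetric] mult.commute)
      finally show "norm (d n x) \<le> (s\<^sup>2) ^ n + w n x" by simp
    qed
    then have "(\<lambda>n. u 0 x + (\<Sum>i<n. d i x)) \<longlonglongrightarrow> u 0 x + (\<Sum>i. d i x)"
      by (intro tendsto_add tendsto_const summable_LIMSEQ)
    moreover have "u 0 x + (\<Sum>i<n. d i x) = u n x" for n
      unfolding d_def by (subst sum_lessThan_telescope) simp
    ultimately have "(\<lambda>n. u n x) \<longlonglongrightarrow> u 0 x + (\<Sum>i. d i x)"
      by simp
    then have lim: "(\<lambda>n. u n x) \<longlonglongrightarrow> v x"
      unfolding v_def by (simp add: limI)
    show ?thesis
    proof (rule LIMSEQ_le_const2)
      show "(\<lambda>n. (u n x - u m x)\<^sup>2) \<longlonglongrightarrow> (v x - u m x)\<^sup>2"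
        by (rule tendsto_power[OF tendsto_diff[OF lim tendsto_const]])
      have "(u n x - u m x)\<^sup>2 \<le> (s\<^sup>2) ^ m / (1 - s\<^sup>2) * W x" if "m \<le> n" for n
      proof -
        have "u n x - u m x = (\<Sum>i\<in>{m..<n}. d i x)"
          unfolding d_def by (rule sum_Suc_diff'[OF that, symmetric])
        also have "\<dots> = (\<Sum>i\<in>{m..<n}. s ^ i * (d i x / s ^ i))"
          using s by simp
        finally have "(u n x - u m x)\<^sup>2
            \<le> (\<Sum>i\<in>{m..<n}. (s ^ i)\<^sup>2) * (\<Sum>i\<in>{m..<n}. (d i x / s ^ i)\<^sup>2)"
          using Cauchy_Schwarz_ineq_sum[of "\<lambda>i. s ^ i" "\<lambda>i. d i x / s ^ i" "{m..<n}"] by simp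
        also have "\<dots> = (\<Sum>i\<in>{m..<n}. (s\<^sup>2) ^ i) * (\<Sum>i\<in>{m..<n}. w i x)"
          by (simp add: w_def power_divide power_mult[symmetric] mult.commute)
        also have "\<dots> \<le> ((s\<^sup>2) ^ m / (1 - s\<^sup>2)) * W x"
        proof (intro mult_mono)
          \<comment> \<open>Each power of r = s^2 is a difference of consecutive values of -r^i / (1
            - r), so the sum telescopes; dropping the term at n leaves the full geometric
            tail.\<close>
          have "(\<Sum>i\<in>{m..<n}. (s\<^sup>2) ^ i)
              = (\<Sum>i\<in>{m..<n}. - ((s\<^sup>2) ^ Suc i / (1 - s\<^sup>2)) - - ((s\<^sup>2) ^ i / (1 - s\<^sup>2)))"
          proof (rule sum.cong)
            have "1 - s\<^sup>2 \<noteq> 0" using s2 by simp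
            then have "a = - (s\<^sup>2 * a / (1 - s\<^sup>2)) - - (a / (1 - s\<^sup>2))" for a
              by (simp add: divide_simps) (simp add: algebra_simps)
            then show "(s\<^sup>2) ^ i = - ((s\<^sup>2) ^ Suc i / (1 - s\<^sup>2)) - - ((s\<^sup>2) ^ i / (1 - s\<^sup>2))" for i
              unfolding power_Suc .
          qed simp
          also have "\<dots> = - ((s\<^sup>2) ^ n / (1 - s\<^sup>2)) - - ((s\<^sup>2) ^ m / (1 - s\<^sup>2))"
            by (rule sum_Suc_diff'[OF that])
          also have "\<dots> \<le> (s\<^sup>2) ^ m / (1 - s\<^sup>2)"
            using s2 by simp
          finally show "(\<Sum>i\<in>{m..<n}. (s\<^sup>2) ^ i) \<le> (s\<^sup>2) ^ m / (1 - s\<^sup>2)" .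
          show "(\<Sum>i\<in>{m..<n}. w i x) \<le> W x"
            unfolding W_def using sw w_nonneg by (intro sum_le_suminf) auto
        qed (use s2 w_nonneg in \<open>auto intro!: sum_nonneg\<close>)
        finally show ?thesis .
      qed
      then show "\<exists>N. \<forall>n\<ge>N. (u n x - u m x)\<^sup>2 \<le> (s\<^sup>2) ^ m / (1 - s\<^sup>2) * W x"
        by blast
    qed
  qed
  have diff: "(\<lambda>x. v x - u m x) \<in> sq_int M" for m
  proof -
    have "integrable M (\<lambda>x. (v x - u m x)\<^sup>2)"
    proof (rule Bochner_Integration.integrable_bound)
      show "integrable M (\<lambda>x. (s\<^sup>2) ^ m / (1 - s\<^sup>2) * W x)"
        using W_int by simp
      show "AE x in M. norm ((v x - u m x)\<^sup>2) \<le> norm ((s\<^sup>2) ^ m / (1 - s\<^sup>2) * W x)"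
        using AE_w
      proof eventually_elim
        case (elim x)
        show ?case
          using order_trans[OF bound[OF elim] abs_ge_self] unfolding real_norm_def abs_power2 .
      qed
    qed simp
    then show ?thesis by (simp add: sq_int_def)
  qed
  have "v \<in> sq_int M"
    using sq_int_add[OF diff[of 0] u[of 0]] by simp
  moreover have "(\<lambda>n. \<integral>x. (v x - u n x)\<^sup>2 \<partial>M) \<longlonglongrightarrow> 0"
  proof (rule tendsto_sandwich)
    show "\<forall>\<^sub>F n in sequentially. 0 \<le> (\<integral>x. (v x - u n x)\<^sup>2 \<partial>M)"
      by simp
    have "(\<integral>x. (v x - u n x)\<^sup>2 \<partial>M) \<le> (\<integral>x. (s\<^sup>2) ^ n / (1 - s\<^sup>2) * W x \<partial>M)" for n
      using AE_w bound W_int diff[of n] by (intro integral_mono_AE) (auto elim: AE_mp)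
    then show "\<forall>\<^sub>F n in sequentially. (\<integral>x. (v x - u n x)\<^sup>2 \<partial>M)
        \<le> (s\<^sup>2) ^ n / (1 - s\<^sup>2) * (\<integral>x. W x \<partial>M)"
      by simp
    have "(\<lambda>n. (s\<^sup>2) ^ n / (1 - s\<^sup>2) * (\<integral>x. W x \<partial>M)) \<longlonglongrightarrow> 0 / (1 - s\<^sup>2) * (\<integral>x. W x \<partial>M)"
      using s2 by (intro tendsto_mult tendsto_divide tendsto_const LIMSEQ_power_zero) auto
    then show "(\<lambda>n. (s\<^sup>2) ^ n / (1 - s\<^sup>2) * (\<integral>x. W x \<partial>M)) \<longlonglongrightarrow> 0"
      by simp
  qed auto
  ultimately show ?thesis by blast
qed

text \<open>The Lax--Milgram argument: for small \<open>\<omega>\<close> the map \<open>u \<mapsto> u - \<omega> (L u - g)\<close> is a contraction.\<close>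

lemma coercive_solvable:
  fixes L :: "('a \<Rightarrow> real) \<Rightarrow> 'a \<Rightarrow> real"
  assumes L: "\<And>f. f \<in> sq_int M \<Longrightarrow> L f \<in> sq_int M"
    and lin: "\<And>f h c. f \<in> sq_int M \<Longrightarrow> h \<in> sq_int M \<Longrightarrow>
      AE x in M. L (\<lambda>x. f x + c * h x) x = L f x + c * L h x"
    and bd: "\<And>f. f \<in> sq_int M \<Longrightarrow> (\<integral>x. (L f x)\<^sup>2 \<partial>M) \<le> C * (\<integral>x. (f x)\<^sup>2 \<partial>M)"
    and coercive: "\<And>f. f \<in> sq_int M \<Longrightarrow> (\<integral>x. (f x)\<^sup>2 \<partial>M) \<le> (\<integral>x. L f x * f x \<partial>M)"
    and g: "g \<in> sq_int M"
  shows "\<exists>v\<in>sq_int M. AE x in M. L v x = g x"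
proof -
  \<comment> \<open>The lower bound 2 gives \<omega> \<le> 1/2 and hence q > 0. As \<omega>^2 D =
    \<omega>, the contraction factor 1 - 2 \<omega> + \<omega>^2 D collapses to q = 1 -
    \<omega>.\<close>
  define D where "D = max C 2"
  define \<omega> where "\<omega> = 1 / D"
  define q where "q = 1 - \<omega>"
  have D: "2 \<le> D" "C \<le> D" by (auto simp: D_def)
  have \<omega>: "0 < \<omega>" "\<omega> \<le> 1/2" "\<omega>\<^sup>2 * D = \<omega>"
    using D by (auto simp: \<omega>_def power2_eq_square field_simps)
  have q: "0 < q" "q < 1" using \<omega> by (auto simp: q_def)
  have sq_nonneg: "0 \<le> (\<integral>x. (f x)\<^sup>2 \<partial>M)" for f :: "'a \<Rightarrow> real"
    by simp
  have contr: "(\<integral>x. (f x + (-\<omega>) * L f x)\<^sup>2 \<partial>M) \<le> q * (\<integral>x. (f x)\<^sup>2 \<partial>M)" if f: "f \<in> sq_int M" for f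
  proof -
    have "(\<integral>x. (f x + (-\<omega>) * L f x)\<^sup>2 \<partial>M)
      = (\<integral>x. (f x)\<^sup>2 \<partial>M) - 2 * \<omega> * (\<integral>x. L f x * f x \<partial>M) + \<omega>\<^sup>2 * (\<integral>x. (L f x)\<^sup>2 \<partial>M)"
      by (subst integral_sq_combination[OF f L[OF f]]) simp
    also have "\<dots> \<le> (\<integral>x. (f x)\<^sup>2 \<partial>M) - 2 * \<omega> * (\<integral>x. (f x)\<^sup>2 \<partial>M) + \<omega>\<^sup>2 * (D * (\<integral>x. (f x)\<^sup>2 \<partial>M))"
    proof (intro add_mono diff_mono mult_left_mono order.refl)
      show "(\<integral>x. (L f x)\<^sup>2 \<partial>M) \<le> D * (\<integral>x. (f x)\<^sup>2 \<partial>M)"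
        using bd[OF f] mult_right_mono[OF D(2) sq_nonneg[of f]] by simp
    qed (use \<omega> coercive[OF f] in auto)
    also have "\<dots> = q * (\<integral>x. (f x)\<^sup>2 \<partial>M)"
      unfolding mult.assoc[symmetric] \<omega>(3) q_def by (simp add: algebra_simps)
    finally show ?thesis .
  qed
  define u where "u = rec_nat (\<lambda>_. 0) (\<lambda>n f x. f x - \<omega> * (L f x - g x))"
  have u_0: "u 0 = (\<lambda>_. 0)"
    and u_Suc: "u (Suc n) = (\<lambda>x. u n x - \<omega> * (L (u n) x - g x))" for n
    by (auto simp: u_def)
  have u: "u n \<in> sq_int M" for n
    by (induction n) (auto simp: u_0 u_Suc intro!: sq_int_diff sq_int_cmult L g)
  define d where "d n x = u (Suc n) x - u n x" for n x
  have d: "d n \<in> sq_int M" for n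
    unfolding d_def using u by auto
  \<comment> \<open>The inhomogeneity \<open>g\<close> cancels in differences of iterates. The
    recursion holds only almost everywhere because \<open>L\<close> is linear only in that
    sense.\<close>
  have d_Suc: "AE x in M. d (Suc n) x = d n x + (-\<omega>) * L (d n) x" for n
  proof -
    have eq: "u (Suc n) = (\<lambda>x. u n x + 1 * d n x)"
      by (auto simp: d_def)
    have "AE x in M. L (u (Suc n)) x = L (u n) x + 1 * L (d n) x"
      unfolding eq by (rule lin[OF u d])
    then show ?thesis
    proof (rule AE_mp, intro AE_I2 impI)
      fix x assume "L (u (Suc n)) x = L (u n) x + 1 * L (d n) x"
      then show "d (Suc n) x = d n x + (-\<omega>) * L (d n) x"
        by (simp add: d_def u_Suc[of "Suc n"]) (simp add: u_Suc[of n] algebra_simps)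
    qed
  qed
  have d_le: "(\<integral>x. (d n x)\<^sup>2 \<partial>M) \<le> (\<integral>x. (d 0 x)\<^sup>2 \<partial>M) * q ^ n" for n
  proof (induction n)
    case (Suc n)
    have "(\<integral>x. (d (Suc n) x)\<^sup>2 \<partial>M) = (\<integral>x. (d n x + (-\<omega>) * L (d n) x)\<^sup>2 \<partial>M)"
      using sq_intD(1)[OF d[of "Suc n"]] sq_intD(1)[OF d[of n]] sq_intD(1)[OF L[OF d[of n]]] d_Suc[of n]
      by (intro integral_cong_AE) (auto elim: AE_mp)
    also have "\<dots> \<le> q * (\<integral>x. (d n x)\<^sup>2 \<partial>M)"
      by (rule contr[OF d])
    also have "\<dots> \<le> q * ((\<integral>x. (d 0 x)\<^sup>2 \<partial>M) * q ^ n)"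
      using Suc q by (intro mult_left_mono) auto
    finally show ?case by (simp add: mult_ac)
  qed simp
  have "\<exists>v\<in>sq_int M. (\<lambda>n. \<integral>x. (v x - u n x)\<^sup>2 \<partial>M) \<longlonglongrightarrow> 0"
    by (rule sq_int_geometric_limit[OF u _ q]) (use d_le in \<open>simp add: d_def\<close>)
  then obtain v where v: "v \<in> sq_int M" and lim: "(\<lambda>n. \<integral>x. (v x - u n x)\<^sup>2 \<partial>M) \<longlonglongrightarrow> 0"
    by blast
  \<comment> \<open>The residual splits into L (v - u_n), controlled by boundedness, and L u_n - g =
    -D d_n, by the choice \<omega> = 1/D. Both tend to zero with n.\<close>
  have res: "(\<integral>x. (L v x - g x)\<^sup>2 \<partial>M)
      \<le> 2 * (C * (\<integral>x. (v x - u n x)\<^sup>2 \<partial>M)) + 2 * (D\<^sup>2 * ((\<integral>x. (d 0 x)\<^sup>2 \<partial>M) * q ^ n))" for n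
  proof -
    have v_u: "(\<lambda>x. v x - u n x) \<in> sq_int M"
      using v u by auto
    have "AE x in M. L (\<lambda>x. u n x + 1 * (v x - u n x)) x = L (u n) x + 1 * L (\<lambda>x. v x - u n x) x"
      by (rule lin[OF u v_u])
    then have AE: "AE x in M. L v x - g x = L (\<lambda>x. v x - u n x) x + (- D) * d n x"
    proof (rule AE_mp, intro AE_I2 impI)
      fix x
      have "D * \<omega> = 1" using D by (simp add: \<omega>_def)
      then have "- D * d n x = L (u n) x - g x"
        by (simp add: d_def u_Suc mult.assoc[symmetric])
      moreover assume "L (\<lambda>x. u n x + 1 * (v x - u n x)) x = L (u n) x + 1 * L (\<lambda>x. v x - u n x) x"
      ultimately show "L v x - g x = L (\<lambda>x. v x - u n x) x + (- D) * d n x"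
        by simp
    qed
    have "(\<integral>x. (L v x - g x)\<^sup>2 \<partial>M) = (\<integral>x. (L (\<lambda>x. v x - u n x) x + (- D) * d n x)\<^sup>2 \<partial>M)"
      using AE sq_intD(1)[OF d[of n]] sq_intD(1)[OF L[OF v]] sq_intD(1)[OF g] sq_intD(1)[OF L[OF v_u]]
      by (intro integral_cong_AE) (auto elim: AE_mp)
    also have "\<dots> \<le> 2 * (\<integral>x. (L (\<lambda>x. v x - u n x) x)\<^sup>2 \<partial>M) + 2 * (\<integral>x. ((- D) * d n x)\<^sup>2 \<partial>M)"
      by (intro integral_sq_add_le L v_u sq_int_cmult d)
    also have "(\<integral>x. ((- D) * d n x)\<^sup>2 \<partial>M) = D\<^sup>2 * (\<integral>x. (d n x)\<^sup>2 \<partial>M)"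
      by (simp add: power_mult_distrib)
    also have "2 * (\<integral>x. (L (\<lambda>x. v x - u n x) x)\<^sup>2 \<partial>M) + 2 * \<dots>
       \<le> 2 * (C * (\<integral>x. (v x - u n x)\<^sup>2 \<partial>M)) + 2 * (D\<^sup>2 * ((\<integral>x. (d 0 x)\<^sup>2 \<partial>M) * q ^ n))"
      using bd[OF v_u] d_le[of n] by (intro add_mono mult_left_mono) auto
    finally show ?thesis .
  qed
  have "(\<integral>x. (L v x - g x)\<^sup>2 \<partial>M) \<le> 0"
  proof (rule LIMSEQ_le_const)
    have "(\<lambda>n. 2 * (C * (\<integral>x. (v x - u n x)\<^sup>2 \<partial>M)) + 2 * (D\<^sup>2 * ((\<integral>x. (d 0 x)\<^sup>2 \<partial>M) * q ^ n)))
      \<longlonglongrightarrow> 2 * (C * 0) + 2 * (D\<^sup>2 * ((\<integral>x. (d 0 x)\<^sup>2 \<partial>M) * 0))"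
      using q by (intro tendsto_intros lim LIMSEQ_power_zero) auto
    then show "(\<lambda>n. 2 * (C * (\<integral>x. (v x - u n x)\<^sup>2 \<partial>M)) + 2 * (D\<^sup>2 * ((\<integral>x. (d 0 x)\<^sup>2 \<partial>M) * q ^ n)))
      \<longlonglongrightarrow> 0"
      by simp
  qed (use res in blast)
  then have "AE x in M. L v x - g x = 0"
    by (intro integral_sq_eq_0_AE sq_int_diff L v g)
  with v show ?thesis by auto
qed

section \<open>Integral operators with Schur kernels\<close>

text \<open>Hypotheses of Schur's test with constant weights and one bound for rows and columns.
  Strict positivity of \<open>B\<close> permits division by it in \<open>op_sq_le\<close>.\<close>

locale schur_kernel = M: sigma_finite_measure M for M :: "'a measure" +
  fixes k :: "'a \<Rightarrow> 'a \<Rightarrow> real" and B :: real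
  assumes kernel_measurable [measurable]: "case_prod k \<in> borel_measurable (M \<Otimes>\<^sub>M M)"
    and kernel_nonneg: "0 \<le> k x y"
    and row_le: "x \<in> space M \<Longrightarrow> (\<integral>\<^sup>+y. k x y \<partial>M) \<le> ennreal B"
    and col_le: "y \<in> space M \<Longrightarrow> (\<integral>\<^sup>+x. k x y \<partial>M) \<le> ennreal B"
    and B_pos: "0 < B"
begin

sublocale pair_sigma_finite M M ..

text \<open>Where the row integrand is not integrable, the value is the default 0; for
  \<open>f\<close> in \<open>sq_int M\<close> this concerns only a null set of
  \<open>x\<close>.\<close>

definition op :: "('a \<Rightarrow> real) \<Rightarrow> 'a \<Rightarrow> real" where
  "op f x = (\<integral>y. k x y * f y \<partial>M)"

text \<open>The hypotheses are symmetric in rows and columns, so results on \<open>op\<close> carry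
  over to the adjoint without a second proof.\<close>

lemma transpose: "schur_kernel M (\<lambda>x y. k y x) B"
proof unfold_locales
  show "(\<lambda>(x, y). k y x) \<in> borel_measurable (M \<Otimes>\<^sub>M M)"
    using measurable_compose[OF measurable_pair_swap' kernel_measurable]
    by (simp add: case_prod_unfold)
qed (auto intro: kernel_nonneg row_le col_le B_pos)

lemma row_integrable:
  assumes "x \<in> space M"
  shows "integrable M (k x)" "(\<integral>y. k x y \<partial>M) \<le> B"
proof -
  have [measurable]: "k x \<in> borel_measurable M"
    using measurable_compose[OF measurable_Pair1'[OF assms] kernel_measurable] by simp
  have "(\<integral>\<^sup>+y. k x y \<partial>M) < \<infinity>"
    using row_le[OF assms] by (simp add: order_le_less_trans)
  then show i: "integrable M (k x)"
    using kernel_nonneg by (intro integrableI_nonneg) auto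
  have "ennreal (\<integral>y. k x y \<partial>M) \<le> ennreal B"
    using row_le[OF assms] nn_integral_eq_integral[OF i] kernel_nonneg by simp
  then show "(\<integral>y. k x y \<partial>M) \<le> B"
    using B_pos by (simp add: ennreal_le_iff)
qed

text \<open>By Tonelli the integration over x may be done first, where the column bound applies;
  what remains is at most \<open>B\<close> times the squared norm of \<open>f\<close>.\<close>

lemma kernel_sq_integrable:
  assumes "f \<in> sq_int M"
  shows "integrable (M \<Otimes>\<^sub>M M) (\<lambda>(x, y). k x y * (f y)\<^sup>2)"
proof (rule integrableI_nonneg)
  have [measurable]: "f \<in> borel_measurable M" using assms by auto
  show "(\<lambda>(x, y). k x y * (f y)\<^sup>2) \<in> borel_measurable (M \<Otimes>\<^sub>M M)"
    by measurable
  show "AE p in M \<Otimes>\<^sub>M M. 0 \<le> (case p of (x, y) \<Rightarrow> k x y * (f y)\<^sup>2)"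
    using kernel_nonneg by (auto intro!: AE_I2)
  have "(\<integral>\<^sup>+p. ennreal (case p of (x, y) \<Rightarrow> k x y * (f y)\<^sup>2) \<partial>(M \<Otimes>\<^sub>M M))
    = (\<integral>\<^sup>+y. (\<integral>\<^sup>+x. ennreal (k x y * (f y)\<^sup>2) \<partial>M) \<partial>M)"
    by (subst nn_integral_snd[symmetric]) auto
  also have "\<dots> = (\<integral>\<^sup>+y. (\<integral>\<^sup>+x. ennreal (k x y) \<partial>M) * ennreal ((f y)\<^sup>2) \<partial>M)"
  proof (rule nn_integral_cong)
    fix y assume "y \<in> space M"
    then have [measurable]: "(\<lambda>x. k x y) \<in> borel_measurable M"
      using measurable_compose[OF measurable_Pair2' kernel_measurable] by simp
    show "(\<integral>\<^sup>+x. ennreal (k x y * (f y)\<^sup>2) \<partial>M) = (\<integral>\<^sup>+x. ennreal (k x y) \<partial>M) * ennreal ((f y)\<^sup>2)"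
      by (simp add: ennreal_mult' kernel_nonneg nn_integral_multc)
  qed
  also have "\<dots> \<le> (\<integral>\<^sup>+y. ennreal B * ennreal ((f y)\<^sup>2) \<partial>M)"
    by (intro nn_integral_mono mult_right_mono col_le) auto
  also have "\<dots> = ennreal B * (\<integral>\<^sup>+y. ennreal ((f y)\<^sup>2) \<partial>M)"
    by (intro nn_integral_cmult) measurable
  also have "(\<integral>\<^sup>+y. ennreal ((f y)\<^sup>2) \<partial>M) = ennreal (\<integral>y. (f y)\<^sup>2 \<partial>M)"
    using assms by (intro nn_integral_eq_integral) auto
  also have "ennreal B * \<dots> < \<infinity>"
    by (simp add: ennreal_mult_less_top)
  finally show "(\<integral>\<^sup>+p. ennreal (case p of (x, y) \<Rightarrow> k x y * (f y)\<^sup>2) \<partial>(M \<Otimes>\<^sub>M M)) < \<infinity>" .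
qed

lemma kernel_sq_row_AE:
  assumes "f \<in> sq_int M"
  shows "AE x in M. integrable M (\<lambda>y. k x y * (f y)\<^sup>2)"
  using AE_integrable_fst'[OF kernel_sq_integrable[OF assms]] by simp

text \<open>From |f| \<le> 1 + f^2, the integrand is dominated by k + k f^2, whose first term is
  integrable by the row bound.\<close>

lemma kernel_row_integrable:
  assumes "f \<in> sq_int M" "x \<in> space M" "integrable M (\<lambda>y. k x y * (f y)\<^sup>2)"
  shows "integrable M (\<lambda>y. k x y * f y)"
proof (rule Bochner_Integration.integrable_bound)
  show "integrable M (\<lambda>y. k x y + k x y * (f y)\<^sup>2)"
    using assms row_integrable by (intro Bochner_Integration.integrable_add) auto
  show "(\<lambda>y. k x y * f y) \<in> borel_measurable M"
    using row_integrable(1)[OF assms(2)] assms(1) by (intro borel_measurable_times) auto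
  have "\<bar>f y\<bar> \<le> 1 + (f y)\<^sup>2" for y
    using abs_mult_le_sum_squares[of 1 "f y"] by simp
  then have "k x y * \<bar>f y\<bar> \<le> k x y + k x y * (f y)\<^sup>2" for y
    using mult_left_mono[OF _ kernel_nonneg[of x y]] by (fastforce simp: distrib_left)
  then show "AE y in M. norm (k x y * f y) \<le> norm (k x y + k x y * (f y)\<^sup>2)"
    using kernel_nonneg by (intro AE_I2) (simp add: abs_mult)
qed

text \<open>Cauchy-Schwarz for the weight \<open>k x\<close>, of total mass at most
  \<open>B\<close>, obtained by expanding the nonnegative integral of k (f - s/B)^2 with s =
  \<open>op f x\<close>. The shift s/B is optimal once the mass is estimated by
  \<open>B\<close>.\<close>

lemma op_sq_le:
  assumes "f \<in> sq_int M" "x \<in> space M" "integrable M (\<lambda>y. k x y * (f y)\<^sup>2)"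
  shows "(op f x)\<^sup>2 \<le> B * (\<integral>y. k x y * (f y)\<^sup>2 \<partial>M)"
proof -
  define s where "s = op f x"
  have i: "integrable M (\<lambda>y. k x y * f y)" "integrable M (k x)"
    using kernel_row_integrable[OF assms] row_integrable(1)[OF assms(2)] by auto
  have "0 \<le> (\<integral>y. k x y * (f y - s / B)\<^sup>2 \<partial>M)"
    using kernel_nonneg by (intro Bochner_Integration.integral_nonneg) auto
  also have "\<dots> = (\<integral>y. k x y * (f y)\<^sup>2 - 2 * (s / B) * (k x y * f y) + (s / B)\<^sup>2 * k x y \<partial>M)"
    by (intro Bochner_Integration.integral_cong) (auto simp: power2_diff algebra_simps)
  also have "\<dots> = (\<integral>y. k x y * (f y)\<^sup>2 \<partial>M) - 2 * (s / B) * s + (s / B)\<^sup>2 * (\<integral>y. k x y \<partial>M)"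
    using i assms(3) by (simp add: s_def op_def)
  also have "\<dots> \<le> (\<integral>y. k x y * (f y)\<^sup>2 \<partial>M) - 2 * (s / B) * s + (s / B)\<^sup>2 * B"
    using row_integrable(2)[OF assms(2)] by (intro add_left_mono mult_left_mono) auto
  also have "\<dots> = (\<integral>y. k x y * (f y)\<^sup>2 \<partial>M) - s\<^sup>2 / B"
    using B_pos by (simp add: power2_eq_square field_simps)
  finally show ?thesis
    using B_pos by (simp add: s_def field_simps)
qed

lemma op_measurable:
  assumes [measurable]: "f \<in> borel_measurable M"
  shows "op f \<in> borel_measurable M"
  unfolding op_def by (rule M.borel_measurable_lebesgue_integral) measurable

lemma op_sq_AE:
  assumes "f \<in> sq_int M"
  shows "AE x in M. (op f x)\<^sup>2 \<le> B * (\<integral>y. k x y * (f y)\<^sup>2 \<partial>M)"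
  using kernel_sq_row_AE[OF assms] AE_space by eventually_elim (rule op_sq_le[OF assms])

lemma op_sq_int:
  assumes "f \<in> sq_int M"
  shows "op f \<in> sq_int M"
proof -
  have "integrable M (\<lambda>x. (op f x)\<^sup>2)"
  proof (rule Bochner_Integration.integrable_bound)
    show "integrable M (\<lambda>x. B * (\<integral>y. k x y * (f y)\<^sup>2 \<partial>M))"
      using integrable_fst'[OF kernel_sq_integrable[OF assms]] by simp
    show "(\<lambda>x. (op f x)\<^sup>2) \<in> borel_measurable M"
      using op_measurable assms by (intro borel_measurable_power) auto
    show "AE x in M. norm ((op f x)\<^sup>2) \<le> norm (B * (\<integral>y. k x y * (f y)\<^sup>2 \<partial>M))"
      using op_sq_AE[OF assms] by eventually_elim simp
  qed
  then show ?thesis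
    using op_measurable assms by (auto simp: sq_int_def)
qed

text \<open>Schur's test: one factor \<open>B\<close> comes from the rows through the pointwise
  bound, the other from the columns after the order of integration is exchanged.\<close>

lemma op_bounded:
  assumes "f \<in> sq_int M"
  shows "(\<integral>x. (op f x)\<^sup>2 \<partial>M) \<le> B\<^sup>2 * (\<integral>x. (f x)\<^sup>2 \<partial>M)"
proof -
  interpret T: schur_kernel M "\<lambda>x y. k y x" B by (rule transpose)
  note i = kernel_sq_integrable[OF assms]
  have "(\<integral>x. (op f x)\<^sup>2 \<partial>M) \<le> (\<integral>x. B * (\<integral>y. k x y * (f y)\<^sup>2 \<partial>M) \<partial>M)"
    using op_sq_AE[OF assms] op_sq_int[OF assms] integrable_fst'[OF i]
    by (intro integral_mono_AE) auto
  also have "\<dots> = B * (\<integral>y. (\<integral>x. k x y * (f y)\<^sup>2 \<partial>M) \<partial>M)"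
    using Fubini_integral[OF i] by simp
  also have "\<dots> = B * (\<integral>y. (\<integral>x. k x y \<partial>M) * (f y)\<^sup>2 \<partial>M)"
    by simp
  also have "\<dots> \<le> B * (\<integral>y. B * (f y)\<^sup>2 \<partial>M)"
  proof (intro mult_left_mono integral_mono)
    show "integrable M (\<lambda>y. (\<integral>x. k x y \<partial>M) * (f y)\<^sup>2)"
      using integrable_snd[OF i] by simp
    show "integrable M (\<lambda>y. B * (f y)\<^sup>2)" using assms by auto
    show "(\<integral>x. k x y \<partial>M) * (f y)\<^sup>2 \<le> B * (f y)\<^sup>2" if "y \<in> space M" for y
      using T.row_integrable(2)[OF that] by (intro mult_right_mono) auto
  qed (use B_pos in simp)
  also have "\<dots> = B\<^sup>2 * (\<integral>x. (f x)\<^sup>2 \<partial>M)"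
    by (simp add: power2_eq_square)
  finally show ?thesis .
qed

text \<open>Additivity of the integral is applied where both rows are integrable, which is known
  only for almost every \<open>x\<close>.\<close>

lemma op_linear:
  assumes "f \<in> sq_int M" "g \<in> sq_int M"
  shows "AE x in M. op (\<lambda>y. f y + c * g y) x = op f x + c * op g x"
  using kernel_sq_row_AE[OF assms(1)] kernel_sq_row_AE[OF assms(2)] AE_space
proof eventually_elim
  fix x assume "integrable M (\<lambda>y. k x y * (f y)\<^sup>2)" "integrable M (\<lambda>y. k x y * (g y)\<^sup>2)" "x \<in> space M"
  then have "integrable M (\<lambda>y. k x y * f y)" "integrable M (\<lambda>y. k x y * g y)"
    using kernel_row_integrable assms by auto
  moreover have "(\<lambda>y. k x y * (f y + c * g y)) = (\<lambda>y. k x y * f y + c * (k x y * g y))"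
    by (auto simp: algebra_simps)
  ultimately show "op (\<lambda>y. f y + c * g y) x = op f x + c * op g x"
    by (simp add: op_def)
qed

text \<open>A null set of y does not affect the integral, so no exceptional set of \<open>x\<close>
  arises. In \<open>tikhonov_linear\<close> this moves an almost-everywhere identity inside
  \<open>adj\<close>.\<close>

lemma op_cong_AE:
  assumes "f \<in> borel_measurable M" "g \<in> borel_measurable M" "AE y in M. f y = g y" "x \<in> space M"
  shows "op f x = op g x"
  unfolding op_def
  using assms row_integrable(1)[OF assms(4)]
  by (intro integral_cong_AE borel_measurable_times) (auto elim: AE_mp)

section \<open>The adjoint operator\<close>

definition adj :: "('a \<Rightarrow> real) \<Rightarrow> 'a \<Rightarrow> real" where
  "adj f y = (\<integral>x. k x y * f x \<partial>M)"

lemma adj_eq: "adj = schur_kernel.op M (\<lambda>x y. k y x)"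
  by (intro ext) (simp add: adj_def schur_kernel.op_def[OF transpose])

lemmas adj_sq_int = schur_kernel.op_sq_int[OF transpose, folded adj_eq]
  and adj_bounded = schur_kernel.op_bounded[OF transpose, folded adj_eq]
  and adj_linear = schur_kernel.op_linear[OF transpose, folded adj_eq]
  and adj_cong_AE = schur_kernel.op_cong_AE[OF transpose, folded adj_eq]

text \<open>Fubini. The integrand k(x,y) f(x) g(y) is dominated by k f(x)^2 + k g(y)^2, whose terms
  are integrable by the kernel estimate for the transposed and for the original kernel.\<close>

lemma adj_adjoint:
  assumes "f \<in> sq_int M" "g \<in> sq_int M"
  shows "(\<integral>y. adj f y * g y \<partial>M) = (\<integral>x. f x * op g x \<partial>M)"
proof -
  interpret T: schur_kernel M "\<lambda>x y. k y x" B by (rule transpose)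
  have [measurable]: "f \<in> borel_measurable M" "g \<in> borel_measurable M" using assms by auto
  have "integrable (M \<Otimes>\<^sub>M M) (\<lambda>(x, y). k x y * f x * g y)"
  proof (rule Bochner_Integration.integrable_bound)
    have "integrable (M \<Otimes>\<^sub>M M) (\<lambda>(x, y). k x y * (f x)\<^sup>2)"
      using integrable_product_swap[OF T.kernel_sq_integrable[OF assms(1)]] by simp
    then show "integrable (M \<Otimes>\<^sub>M M) (\<lambda>p. (case p of (x, y) \<Rightarrow> k x y * (f x)\<^sup>2) + (case p of (x, y) \<Rightarrow> k x y * (g y)\<^sup>2))"
      using kernel_sq_integrable[OF assms(2)] by (rule Bochner_Integration.integrable_add)
    show "(\<lambda>(x, y). k x y * f x * g y) \<in> borel_measurable (M \<Otimes>\<^sub>M M)"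
      by measurable
    have "\<bar>k x y * f x * g y\<bar> \<le> \<bar>k x y * (f x)\<^sup>2 + k x y * (g y)\<^sup>2\<bar>" for x y
      using mult_left_mono[OF abs_mult_le_sum_squares[of "f x" "g y"] kernel_nonneg[of x y]] kernel_nonneg[of x y]
      by (simp add: abs_mult distrib_left mult.assoc)
    then show "AE p in M \<Otimes>\<^sub>M M. norm (case p of (x, y) \<Rightarrow> k x y * f x * g y)
        \<le> norm ((case p of (x, y) \<Rightarrow> k x y * (f x)\<^sup>2) + (case p of (x, y) \<Rightarrow> k x y * (g y)\<^sup>2))"
      by (intro AE_I2) (simp add: case_prod_unfold)
  qed
  from Fubini_integral[OF this]
  have "(\<integral>y. (\<integral>x. k x y * f x * g y \<partial>M) \<partial>M) = (\<integral>x. (\<integral>y. f x * (k x y * g y) \<partial>M) \<partial>M)"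
    by (simp add: mult_ac)
  then show ?thesis
    by (simp only: adj_def op_def integral_mult_left_zero integral_mult_right_zero)
qed

section \<open>The normal equation and the energy identity\<close>

text \<open>Adjointness turns the pairing of K'K f with f into the squared norm of
  \<open>op f\<close>. Hence K'K + 1 is coercive with constant 1.\<close>

lemma tikhonov_coercive:
  assumes f: "f \<in> sq_int M"
  shows "(\<integral>x. (adj (op f) x + f x) * f x \<partial>M) = (\<integral>x. (op f x)\<^sup>2 \<partial>M) + (\<integral>x. (f x)\<^sup>2 \<partial>M)"
proof -
  have "(\<integral>x. (adj (op f) x + f x) * f x \<partial>M) = (\<integral>x. adj (op f) x * f x \<partial>M) + (\<integral>x. f x * f x \<partial>M)"
    unfolding distrib_right
    by (intro Bochner_Integration.integral_add sq_int_mult_integrable adj_sq_int op_sq_int f)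
  then show ?thesis
    by (simp add: adj_adjoint[OF op_sq_int[OF f] f] power2_eq_square)
qed

text \<open>The inner linearity holds almost everywhere, and \<open>adj\<close> does not see null
  sets, so only the outer linearity leaves an exceptional set.\<close>

lemma tikhonov_linear:
  assumes "f \<in> sq_int M" "h \<in> sq_int M"
  shows "AE x in M. adj (op (\<lambda>x. f x + c * h x)) x + (f x + c * h x)
    = (adj (op f) x + f x) + c * (adj (op h) x + h x)"
  using adj_linear[OF op_sq_int[OF assms(1)] op_sq_int[OF assms(2)], of c] AE_space
proof eventually_elim
  case (elim x)
  have "adj (op (\<lambda>x. f x + c * h x)) x = adj (\<lambda>x. op f x + c * op h x) x"
    using op_linear[OF assms] assms sq_int_add sq_int_cmult elim(2)
    by (intro adj_cong_AE op_measurable borel_measurable_add borel_measurable_times) auto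
  with elim(1) show ?case by (simp add: algebra_simps)
qed

text \<open>Instance of \<open>coercive_solvable\<close> for K'K + 1. Squared norms grow at most by
  B^2 under each of \<open>op\<close> and \<open>adj\<close>, and adding the identity costs a factor
  2; this gives the constant 2 B^4 + 2.\<close>

lemma tikhonov_equation_solvable:
  assumes "g \<in> sq_int M"
  shows "\<exists>v\<in>sq_int M. AE x in M. adj (op v) x + v x = g x"
proof (rule coercive_solvable[OF _ tikhonov_linear _ _ assms])
  fix f assume f: "f \<in> sq_int M"
  show "(\<lambda>x. adj (op f) x + f x) \<in> sq_int M"
    by (intro sq_int_add adj_sq_int op_sq_int f)
  have "(\<integral>x. (adj (op f) x + f x)\<^sup>2 \<partial>M) \<le> 2 * (\<integral>x. (adj (op f) x)\<^sup>2 \<partial>M) + 2 * (\<integral>x. (f x)\<^sup>2 \<partial>M)"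
    by (intro integral_sq_add_le adj_sq_int op_sq_int f)
  also have "(\<integral>x. (adj (op f) x)\<^sup>2 \<partial>M) \<le> B\<^sup>2 * (B\<^sup>2 * (\<integral>x. (f x)\<^sup>2 \<partial>M))"
    using adj_bounded[OF op_sq_int[OF f]] op_bounded[OF f]
    by (meson mult_left_mono order_trans zero_le_power2)
  finally show "(\<integral>x. (adj (op f) x + f x)\<^sup>2 \<partial>M) \<le> (2 * (B\<^sup>2 * B\<^sup>2) + 2) * (\<integral>x. (f x)\<^sup>2 \<partial>M)"
    by (simp add: algebra_simps)
  show "(\<integral>x. (f x)\<^sup>2 \<partial>M) \<le> (\<integral>x. (adj (op f) x + f x) * f x \<partial>M)"
    unfolding tikhonov_coercive[OF f] by simp
qed

text \<open>With d = u - v the data term contributes the cross term -2 <d, g - v> and the penalty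
  contributes 2 <K d, K v>. By the equation g - v = K'K v almost everywhere, so adjointness makes
  them cancel.\<close>

lemma tikhonov_energy:
  assumes v: "v \<in> sq_int M" and u: "u \<in> sq_int M" and g: "g \<in> sq_int M"
    and eq: "AE x in M. adj (op v) x + v x = g x"
  shows "(\<integral>x. (g x - u x)\<^sup>2 + (op u x)\<^sup>2 \<partial>M)
    = (\<integral>x. (g x - v x)\<^sup>2 + (op v x)\<^sup>2 \<partial>M)
      + (\<integral>x. (u x - v x)\<^sup>2 \<partial>M) + (\<integral>x. (op (\<lambda>x. u x - v x) x)\<^sup>2 \<partial>M)"
proof -
  define d where "d x = u x - v x" for x
  have d: "d \<in> sq_int M" unfolding d_def using u v by auto
  have u_eq: "u = (\<lambda>x. v x + 1 * d x)" by (auto simp: d_def)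
  note sq = v u g d op_sq_int[OF v] op_sq_int[OF u] op_sq_int[OF d] adj_sq_int[OF op_sq_int[OF v]]
  have gv: "(\<lambda>x. g x - v x) \<in> sq_int M" using g v by auto
  have split: "(\<integral>x. (g x - w x)\<^sup>2 + (op w x)\<^sup>2 \<partial>M) = (\<integral>x. (g x - w x)\<^sup>2 \<partial>M) + (\<integral>x. (op w x)\<^sup>2 \<partial>M)"
    if "w \<in> sq_int M" for w
    using that g op_sq_int[OF that] sq_int_diff[OF g that]
    by (intro Bochner_Integration.integral_add) auto
  have "(\<integral>x. d x * (g x - v x) \<partial>M) = (\<integral>x. adj (op v) x * d x \<partial>M)"
    using eq sq[THEN sq_intD(1)]
    by (intro integral_cong_AE borel_measurable_times borel_measurable_diff) (auto elim: AE_mp)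
  also have "\<dots> = (\<integral>x. op v x * op d x \<partial>M)"
    by (rule adj_adjoint[OF op_sq_int[OF v] d])
  finally have cross: "(\<integral>x. d x * (g x - v x) \<partial>M) = (\<integral>x. op d x * op v x \<partial>M)"
    by (simp add: mult.commute)
  have "(\<integral>x. (g x - u x)\<^sup>2 \<partial>M) = (\<integral>x. ((g x - v x) + (-1) * d x)\<^sup>2 \<partial>M)"
    by (simp add: d_def)
  also have "\<dots> = (\<integral>x. (g x - v x)\<^sup>2 \<partial>M) - 2 * (\<integral>x. d x * (g x - v x) \<partial>M) + (\<integral>x. (d x)\<^sup>2 \<partial>M)"
    by (subst integral_sq_combination[OF gv d]) simp
  finally have 1: "(\<integral>x. (g x - u x)\<^sup>2 \<partial>M)
    = (\<integral>x. (g x - v x)\<^sup>2 \<partial>M) - 2 * (\<integral>x. d x * (g x - v x) \<partial>M) + (\<integral>x. (d x)\<^sup>2 \<partial>M)" .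
  have "AE x in M. op u x = op v x + 1 * op d x"
    unfolding u_eq by (rule op_linear[OF v d])
  then have "(\<integral>x. (op u x)\<^sup>2 \<partial>M) = (\<integral>x. (op v x + 1 * op d x)\<^sup>2 \<partial>M)"
    using sq[THEN sq_intD(1)]
    by (intro integral_cong_AE borel_measurable_power borel_measurable_add borel_measurable_times)
      (auto elim: AE_mp)
  also have "\<dots> = (\<integral>x. (op v x)\<^sup>2 \<partial>M) + 2 * (\<integral>x. op d x * op v x \<partial>M) + (\<integral>x. (op d x)\<^sup>2 \<partial>M)"
    by (subst integral_sq_combination[OF op_sq_int[OF v] op_sq_int[OF d]]) simp
  finally show ?thesis
    using 1 cross by (simp add: split[OF u] split[OF v] flip: d_def)
qed

text \<open>The energy identity is used from v to w and from w to v. On adding, the energies cancel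
  and a vanishing sum of four squared norms remains.\<close>

lemma tikhonov_solution_unique:
  assumes v: "v \<in> sq_int M" and w: "w \<in> sq_int M" and g: "g \<in> sq_int M"
    and "AE x in M. adj (op v) x + v x = g x" "AE x in M. adj (op w) x + w x = g x"
  shows "AE x in M. w x = v x"
proof -
  have d: "(\<lambda>x. w x - v x) \<in> sq_int M" "(\<lambda>x. v x - w x) \<in> sq_int M" using v w by auto
  have sum0: "(\<integral>x. (w x - v x)\<^sup>2 \<partial>M) + (\<integral>x. (v x - w x)\<^sup>2 \<partial>M)
      + (\<integral>x. (op (\<lambda>x. w x - v x) x)\<^sup>2 \<partial>M) + (\<integral>x. (op (\<lambda>x. v x - w x) x)\<^sup>2 \<partial>M) = 0"
    using tikhonov_energy[OF v w g assms(4)] tikhonov_energy[OF w v g assms(5)] by linarith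
  have "0 \<le> (\<integral>x. (f x)\<^sup>2 \<partial>M)" for f :: "'a \<Rightarrow> real" by simp
  from this[of "\<lambda>x. v x - w x"] this[of "op (\<lambda>x. w x - v x)"] this[of "op (\<lambda>x. v x - w x)"]
  have "(\<integral>x. (w x - v x)\<^sup>2 \<partial>M) \<le> 0"
    using sum0 by linarith
  then show ?thesis
    using integral_sq_eq_0_AE[OF d(1)] by simp
qed

end

section \<open>The fractional kernel\<close>

lemma L2_on_eq_sq_int: "L2_on T = sq_int (lebesgue_on {0..T})"
  by (simp add: L2_on_def sq_int_def)

text \<open>The fractional integrals range over intervals depending on t. Moving that dependence
  into an indicator makes it part of a kernel over the fixed measure on [0,T].\<close>

lemma lebesgue_on_integral_subset:
  fixes f :: "real \<Rightarrow> real"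
  assumes "S \<in> sets lebesgue" "S' \<in> sets lebesgue" "S \<subseteq> S'"
  shows "(\<integral>z. f z \<partial>lebesgue_on S) = (\<integral>z. indicator S z * f z \<partial>lebesgue_on S')"
proof -
  have "(\<integral>z. indicator S z * f z \<partial>lebesgue_on S') = (\<integral>z. indicator S' z *\<^sub>R (indicator S z * f z) \<partial>lebesgue)"
    using assms by (intro integral_restrict_space) simp
  also have "\<dots> = (\<integral>z. indicator S z *\<^sub>R f z \<partial>lebesgue)"
    using assms(3) by (intro Bochner_Integration.integral_cong) (auto simp: indicator_def)
  also have "\<dots> = (\<integral>z. f z \<partial>lebesgue_on S)"
    using assms by (intro integral_restrict_space[symmetric]) simp
  finally show ?thesis by simp
qed

section \<open>Integrals of truncated powers\<close>

text \<open>Passes from Lebesgue measure to \<open>lborel\<close>, where the power integrals are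
  computed by affine substitution.\<close>

lemma nn_integral_lebesgue_on_Icc:
  "(\<integral>\<^sup>+z. f z \<partial>lebesgue_on {a..b::real}) = (\<integral>\<^sup>+z. f z * indicator {a..b} z \<partial>lborel)"
  by (subst nn_integral_restrict_space) (auto simp: nn_integral_completion)

lemma nn_integral_powr_from_0:
  fixes a c :: real
  assumes "0 < a" "0 \<le> c"
  shows "(\<integral>\<^sup>+x. ennreal (x powr (a - 1)) * indicator {0..c} x \<partial>lborel) = ennreal (c powr a / a)"
  using has_integral_powr_from_0[of "a - 1" c] assms
  by (intro nn_integral_has_integral_lebesgue') auto

lemma nn_integral_powr_below:
  fixes a t :: real
  assumes "0 < a" "0 \<le> t"
  shows "(\<integral>\<^sup>+z. ennreal ((t - z) powr (a - 1)) * indicator {0..t} z \<partial>lborel) = ennreal (t powr a / a)"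
proof -
  have "(\<integral>\<^sup>+z. ennreal ((t - z) powr (a - 1)) * indicator {0..t} z \<partial>lborel)
     = (\<integral>\<^sup>+x. ennreal (x powr (a - 1)) * indicator {0..t} (t - x) \<partial>lborel)"
    by (subst nn_integral_real_affine[where c = "-1" and t = t]) auto
  also have "\<dots> = (\<integral>\<^sup>+x. ennreal (x powr (a - 1)) * indicator {0..t} x \<partial>lborel)"
    by (intro nn_integral_cong) (auto simp: indicator_def)
  finally show ?thesis using nn_integral_powr_from_0[OF assms] by simp
qed

lemma nn_integral_powr_above:
  fixes a z T :: real
  assumes "0 < a" "z \<le> T"
  shows "(\<integral>\<^sup>+t. ennreal ((t - z) powr (a - 1)) * indicator {z..T} t \<partial>lborel) = ennreal ((T - z) powr a / a)"
proof -
  have "(\<integral>\<^sup>+t. ennreal ((t - z) powr (a - 1)) * indicator {z..T} t \<partial>lborel)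
     = (\<integral>\<^sup>+x. ennreal (x powr (a - 1)) * indicator {z..T} (z + x) \<partial>lborel)"
    by (subst nn_integral_real_affine[where c = 1 and t = z]) auto
  also have "\<dots> = (\<integral>\<^sup>+x. ennreal (x powr (a - 1)) * indicator {0..T - z} x \<partial>lborel)"
    by (intro nn_integral_cong) (auto simp: indicator_def)
  finally show ?thesis using nn_integral_powr_from_0[of a "T - z"] assms by simp
qed

section \<open>The kernel and its Schur bounds\<close>

text \<open>The indicator encodes the Volterra range of integration, so that both arguments may run
  over all of [0,T].\<close>

definition K_kernel :: "real \<Rightarrow> real \<Rightarrow> real \<Rightarrow> real" where
  "K_kernel H t z = inverse (C1 H) / Gamma (1/2 - H) *
     (indicator {0..t} z * (t powr (H - 1/2) * (t - z) powr (1/2 - H - 1) * z powr (1/2 - H)))"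

lemma C1_nonneg:
  assumes "0 < H" "H < 1/2"
  shows "0 \<le> C1 H"
  using assms unfolding C1_def
  by (intro real_sqrt_ge_zero divide_nonneg_nonneg mult_nonneg_nonneg less_imp_le[OF Gamma_real_pos]) auto

lemma K_kernel_nonneg:
  assumes "0 < H" "H < 1/2"
  shows "0 \<le> K_kernel H t z"
  using C1_nonneg[OF assms] Gamma_real_pos[of "1/2 - H"] assms
  unfolding K_kernel_def by (intro mult_nonneg_nonneg divide_nonneg_nonneg) auto

text \<open>For 0 \<le> z \<le> t with t > 0 the two outer powers combine to (z/t)^(1/2 - H) \<le>
  1, which leaves only the convolution singularity at z = t.\<close>

lemma K_kernel_le:
  assumes "0 < H" "H < 1/2"
  shows "K_kernel H t z \<le> inverse (C1 H) / Gamma (1/2 - H) * ((t - z) powr (1/2 - H - 1) * indicator {0..t} z)"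
proof -
  have "t powr (H - 1/2) * z powr (1/2 - H) \<le> 1" if "0 \<le> z" "z \<le> t"
  \<comment> \<open>At t = 0 the convention \<open>0 powr a = 0\<close> makes the product zero;
    otherwise \<open>z\<close> is replaced by \<open>t\<close> and the powers cancel.\<close>
  proof (cases "t = 0")
    case False
    have "t powr (H - 1/2) * z powr (1/2 - H) \<le> t powr (H - 1/2) * t powr (1/2 - H)"
      using that assms by (intro mult_left_mono powr_mono2) auto
    also have "\<dots> = 1"
      using False by (simp flip: powr_add)
    finally show ?thesis .
  qed simp
  then have "(t - z) powr (1/2 - H - 1) * (t powr (H - 1/2) * z powr (1/2 - H)) \<le> (t - z) powr (1/2 - H - 1)"
    if "z \<in> {0..t}"
    using that by (intro mult_left_le) auto
  then have "indicator {0..t} z * (t powr (H - 1/2) * (t - z) powr (1/2 - H - 1) * z powr (1/2 - H))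
      \<le> (t - z) powr (1/2 - H - 1) * indicator {0..t} z"
    by (auto simp: indicator_def mult_ac)
  then show ?thesis
    using C1_nonneg[OF assms] Gamma_real_pos[of "1/2 - H"] assms
    unfolding K_kernel_def by (intro mult_left_mono divide_nonneg_nonneg) auto
qed

lemma K_kernel_schur:
  assumes H: "0 < H" "H < 1/2" and T: "0 < T"
  shows "\<exists>B. schur_kernel (lebesgue_on {0..T}) (K_kernel H) B"
proof -
  define a where "a = 1/2 - H"
  define c where "c = inverse (C1 H) / Gamma a"
  \<comment> \<open>Rows and columns of the majorant integrate to c t^a / a and c (T - z)^a / a,
    both at most c T^a / a. The summand 1 secures \<open>0 < B\<close>, since \<open>c\<close> is
    only known to be nonnegative.\<close>
  define B where "B = c * (T powr a / a) + 1"
  have a: "0 < a" using H by (simp add: a_def)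
  have c: "0 \<le> c" using C1_nonneg[OF H] Gamma_real_pos[OF a] by (simp add: c_def)
  \<comment> \<open>As a map from the interval with its Lebesgue sigma-algebra to the Borel line,
    the identity pulls the Borel measurability of the kernel back to the product space.\<close>
  have [measurable]: "id \<in> lebesgue_on {0..T} \<rightarrow>\<^sub>M borel"
    by (intro measurable_restrict_space1 measurable_completion) (simp add: id_def)
  interpret finite_measure "lebesgue_on {0..T}"
    by (rule finite_measure_lebesgue_on) simp
  have le: "ennreal (K_kernel H t z) \<le> ennreal c * (ennreal ((t - z) powr (a - 1)) * indicator {0..t} z)" for t z
  proof -
    have "K_kernel H t z \<le> c * ((t - z) powr (a - 1) * indicator {0..t} z)"
      using K_kernel_le[OF H, of t z] by (simp add: a_def c_def)
    then have "ennreal (K_kernel H t z) \<le> ennreal (c * ((t - z) powr (a - 1) * indicator {0..t} z))"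
      by (rule ennreal_leI)
    also have "\<dots> = ennreal c * (ennreal ((t - z) powr (a - 1)) * indicator {0..t} z)"
      using c by (simp add: ennreal_mult' ennreal_mult'' ennreal_indicator)
    finally show ?thesis .
  qed
  have le_B: "ennreal c * ennreal (r powr a / a) \<le> ennreal B" if "0 \<le> r" "r \<le> T" for r
  proof -
    have "r powr a / a \<le> T powr a / a"
      using that a by (intro divide_right_mono powr_mono2) auto
    then have "c * (r powr a / a) \<le> B"
      unfolding B_def using mult_left_mono[OF _ c] by fastforce
    moreover have "0 \<le> r powr a / a" using a by simp
    ultimately show ?thesis
      using c by (simp flip: ennreal_mult) (simp add: ennreal_leI)
  qed
  have "schur_kernel (lebesgue_on {0..T}) (K_kernel H) B"
  proof unfold_locales
    have "(\<lambda>p. K_kernel H (fst p) (snd p)) \<in> borel_measurable (borel \<Otimes>\<^sub>M borel)"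
      unfolding K_kernel_def indicator_def atLeastAtMost_iff by measurable
    moreover have "(\<lambda>p. (id (fst p), id (snd p))) \<in> lebesgue_on {0..T} \<Otimes>\<^sub>M lebesgue_on {0..T} \<rightarrow>\<^sub>M borel \<Otimes>\<^sub>M borel"
      by measurable
    ultimately have "(\<lambda>p. K_kernel H (fst (id (fst p), id (snd p))) (snd (id (fst p), id (snd p))))
       \<in> borel_measurable (lebesgue_on {0..T} \<Otimes>\<^sub>M lebesgue_on {0..T})"
      by (rule measurable_compose[rotated])
    then show "case_prod (K_kernel H) \<in> borel_measurable (lebesgue_on {0..T} \<Otimes>\<^sub>M lebesgue_on {0..T})"
      by (simp add: case_prod_unfold)
    show "0 \<le> K_kernel H x y" for x y by (rule K_kernel_nonneg[OF H])
    show "0 < B" using c a by (simp add: B_def add_nonneg_pos)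
    show "(\<integral>\<^sup>+z. K_kernel H t z \<partial>lebesgue_on {0..T}) \<le> ennreal B" if "t \<in> space (lebesgue_on {0..T})" for t
    proof -
      have t: "0 \<le> t" "t \<le> T" using that by auto
      have "(\<integral>\<^sup>+z. K_kernel H t z \<partial>lebesgue_on {0..T})
        \<le> (\<integral>\<^sup>+z. ennreal c * (ennreal ((t - z) powr (a - 1)) * indicator {0..t} z) \<partial>lborel)"
        unfolding nn_integral_lebesgue_on_Icc
      proof (rule nn_integral_mono)
        show "ennreal (K_kernel H t z) * indicator {0..T} z
            \<le> ennreal c * (ennreal ((t - z) powr (a - 1)) * indicator {0..t} z)" for z
          using le[of t z] by (cases "z \<in> {0..T}") simp_all
      qed
      also have "\<dots> = ennreal c * ennreal (t powr a / a)"
        using nn_integral_powr_below[OF a t(1)] by (subst nn_integral_cmult) auto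
      also have "\<dots> \<le> ennreal B" using t by (rule le_B)
      finally show ?thesis .
    qed
    show "(\<integral>\<^sup>+t. K_kernel H t z \<partial>lebesgue_on {0..T}) \<le> ennreal B" if "z \<in> space (lebesgue_on {0..T})" for z
    proof -
      have z: "0 \<le> z" "z \<le> T" using that by auto
      have "(\<integral>\<^sup>+t. K_kernel H t z \<partial>lebesgue_on {0..T})
        \<le> (\<integral>\<^sup>+t. ennreal c * (ennreal ((t - z) powr (a - 1)) * indicator {z..T} t) \<partial>lborel)"
        unfolding nn_integral_lebesgue_on_Icc
      proof (rule nn_integral_mono)
        fix t
        have "indicator {0..t} z = (indicator {z..T} t :: ennreal)" if "t \<in> {0..T}"
          using that z by (auto simp: indicator_def)
        then show "ennreal (K_kernel H t z) * indicator {0..T} t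
            \<le> ennreal c * (ennreal ((t - z) powr (a - 1)) * indicator {z..T} t)"
          using le[of t z] by (cases "t \<in> {0..T}") simp_all
      qed
      also have "\<dots> = ennreal c * ennreal ((T - z) powr a / a)"
        using nn_integral_powr_above[OF a z(2)] by (subst nn_integral_cmult) auto
      also have "\<dots> \<le> ennreal B" using z by (intro le_B) auto
      finally show ?thesis .
    qed
  qed
  then show ?thesis by blast
qed

section \<open>The operators of the statement as integral operators\<close>

lemma K_star_eq_integral:
  assumes "t \<in> {0..T}"
  shows "K_star H f t = (\<integral>z. K_kernel H t z * f z \<partial>lebesgue_on {0..T})"
proof -
  have "(\<integral>z. (t - z) powr (1/2 - H - 1) * (z powr (1/2 - H) * f z) \<partial>lebesgue_on {0..t})
    = (\<integral>z. indicator {0..t} z * ((t - z) powr (1/2 - H - 1) * (z powr (1/2 - H) * f z)) \<partial>lebesgue_on {0..T})"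
    using assms by (intro lebesgue_on_integral_subset) auto
  then have "K_star H f t = inverse (C1 H) / Gamma (1/2 - H) * t powr (H - 1/2) *
      (\<integral>z. indicator {0..t} z * ((t - z) powr (1/2 - H - 1) * (z powr (1/2 - H) * f z)) \<partial>lebesgue_on {0..T})"
    by (simp add: K_star_def RL_left_def)
  also have "\<dots> = (\<integral>z. inverse (C1 H) / Gamma (1/2 - H) * t powr (H - 1/2) *
      (indicator {0..t} z * ((t - z) powr (1/2 - H - 1) * (z powr (1/2 - H) * f z))) \<partial>lebesgue_on {0..T})"
    by (rule integral_mult_right_zero[symmetric])
  also have "\<dots> = (\<integral>z. K_kernel H t z * f z \<partial>lebesgue_on {0..T})"
    by (intro Bochner_Integration.integral_cong) (simp_all add: K_kernel_def)
  finally show ?thesis .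
qed

text \<open>The power z^(2H-1) is the square of z^(H-1/2), at z = 0 too by the convention for
  \<open>powr\<close>: one factor belongs to the transposed kernel, the other to
  \<open>K_star\<close>. The constant C1^(-2) splits alike.\<close>

lemma RL_right_eq_integral:
  assumes "t \<in> {0..T}"
  shows "inverse ((C1 H)\<^sup>2) * t powr (1/2 - H) *
      RL_right T (1/2 - H) (\<lambda>z. z powr (2 * H - 1) * RL_left (1/2 - H) (\<lambda>s. s powr (1/2 - H) * f s) z) t
    = (\<integral>z. K_kernel H z t * K_star H f z \<partial>lebesgue_on {0..T})" (is "?lhs = _")
proof -
  let ?R = "RL_left (1/2 - H) (\<lambda>s. s powr (1/2 - H) * f s)"
  have "(\<integral>z. (z - t) powr (1/2 - H - 1) * (z powr (2 * H - 1) * ?R z) \<partial>lebesgue_on {t..T})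
    = (\<integral>z. indicator {t..T} z * ((z - t) powr (1/2 - H - 1) * (z powr (2 * H - 1) * ?R z)) \<partial>lebesgue_on {0..T})"
    using assms by (intro lebesgue_on_integral_subset) auto
  then have "?lhs = inverse ((C1 H)\<^sup>2) / Gamma (1/2 - H) * t powr (1/2 - H) *
      (\<integral>z. indicator {t..T} z * ((z - t) powr (1/2 - H - 1) * (z powr (2 * H - 1) * ?R z)) \<partial>lebesgue_on {0..T})"
    by (simp add: RL_right_def)
  also have "\<dots> = (\<integral>z. inverse ((C1 H)\<^sup>2) / Gamma (1/2 - H) * t powr (1/2 - H) *
      (indicator {t..T} z * ((z - t) powr (1/2 - H - 1) * (z powr (2 * H - 1) * ?R z))) \<partial>lebesgue_on {0..T})"
    by (rule integral_mult_right_zero[symmetric])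
  also have "\<dots> = (\<integral>z. K_kernel H z t * K_star H f z \<partial>lebesgue_on {0..T})"
  proof (intro Bochner_Integration.integral_cong refl)
    fix z assume z: "z \<in> space (lebesgue_on {0..T})"
    have p: "z powr (2 * H - 1) = z powr (H - 1/2) * z powr (H - 1/2)"
      by (simp flip: powr_add)
    have i: "indicator {t..T} z = (indicator {0..z} t :: real)"
      using z assms by (auto simp: indicator_def)
    show "inverse ((C1 H)\<^sup>2) / Gamma (1/2 - H) * t powr (1/2 - H) *
        (indicator {t..T} z * ((z - t) powr (1/2 - H - 1) * (z powr (2 * H - 1) * ?R z)))
      = K_kernel H z t * K_star H f z"
      unfolding p i K_kernel_def K_star_def by (simp add: power2_eq_square)
  qed
  finally show ?thesis .
qed

section \<open>The integral equation and the minimization problem\<close>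

theorem theorem3p8:
  fixes H T :: real and g g' :: "real \<Rightarrow> real"
  assumes "0 < H" "H < 1/2" "0 < T"
    and "abs_cont_on 0 T g"
    and "g' \<in> L2_on T"
    and "\<And>t. t \<in> {0..T} \<Longrightarrow> g t = (\<integral>s. g' s \<partial>lebesgue_on {0..t})"
  shows "(\<exists>x. unique_in_L2 T (solves_eq H T g') x) \<and>
         (\<forall>x. unique_in_L2 T (solves_eq H T g') x \<longrightarrow>
              unique_in_L2 T (is_arg_min (energy H T g') (\<lambda>u. u \<in> L2_on T)) x)"
proof -
  let ?M = "lebesgue_on {0..T}"
  obtain B where "schur_kernel ?M (K_kernel H) B"
    using K_kernel_schur[OF assms(1-3)] by blast
  then interpret schur_kernel ?M "K_kernel H" B .
  \<comment> \<open>The identification is pointwise on [0,T] only, which suffices because all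
    integrals and almost-everywhere statements below refer to \<open>?M\<close>.\<close>
  have op: "K_star H f t = op f t" if "t \<in> space ?M" for f t
    using K_star_eq_integral[of t T H f] that by (simp add: op_def)
  have adj: "(\<integral>z. K_kernel H z t * K_star H f z \<partial>?M) = adj (op f) t" for f t
    unfolding adj_def by (intro Bochner_Integration.integral_cong) (simp_all add: op)
  have solves: "solves_eq H T g' f \<longleftrightarrow> (AE t in ?M. adj (op f) t + f t = g' t)" for f
    unfolding solves_eq_def by (intro AE_cong) (use RL_right_eq_integral adj in simp)
  have energy: "energy H T g' f = (\<integral>t. (g' t - f t)\<^sup>2 + (op f t)\<^sup>2 \<partial>?M)" for f
    unfolding energy_def Let_def by (intro Bochner_Integration.integral_cong) (simp_all add: op)
  have g': "g' \<in> sq_int ?M" using assms(5) by (simp add: L2_on_eq_sq_int)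
  have "\<exists>x. unique_in_L2 T (solves_eq H T g') x"
  proof -
    obtain v where v: "v \<in> sq_int ?M" "AE t in ?M. adj (op v) t + v t = g' t"
      using tikhonov_equation_solvable[OF g'] by blast
    then have "unique_in_L2 T (solves_eq H T g') v"
      using tikhonov_solution_unique[OF v(1) _ g' v(2)]
      by (auto simp: unique_in_L2_def L2_on_eq_sq_int solves)
    then show ?thesis by blast
  qed
  moreover have "unique_in_L2 T (is_arg_min (energy H T g') (\<lambda>u. u \<in> L2_on T)) x"
    if "unique_in_L2 T (solves_eq H T g') x" for x
  proof -
    have x: "x \<in> sq_int ?M" "AE t in ?M. adj (op x) t + x t = g' t"
      using that by (auto simp: unique_in_L2_def L2_on_eq_sq_int solves)
    \<comment> \<open>The energy identity without its nonnegative term for K (u - x). The remaining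
      squared distance yields both minimality of \<open>x\<close> and uniqueness of the
      minimizer.\<close>
    have gap: "energy H T g' x + (\<integral>t. (u t - x t)\<^sup>2 \<partial>?M) \<le> energy H T g' u" if "u \<in> sq_int ?M" for u
      using tikhonov_energy[OF x(1) that g' x(2)] by (simp add: energy)
    have "energy H T g' x \<le> energy H T g' u" if "u \<in> sq_int ?M" for u
      by (rule order_trans[OF _ gap[OF that]]) simp
    then have "is_arg_min (energy H T g') (\<lambda>u. u \<in> L2_on T) x"
      using x(1) by (auto simp: is_arg_min_def L2_on_eq_sq_int not_less)
    moreover have "AE t in ?M. y t = x t"
      if "y \<in> sq_int ?M" "is_arg_min (energy H T g') (\<lambda>u. u \<in> L2_on T) y" for y
    proof -
      have "energy H T g' y \<le> energy H T g' x"
        using that(2) x(1) by (auto simp: is_arg_min_def L2_on_eq_sq_int not_less)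
      then have "(\<integral>t. (y t - x t)\<^sup>2 \<partial>?M) \<le> 0"
        using gap[OF that(1)] by linarith
      then have "AE t in ?M. y t - x t = 0"
        by (intro integral_sq_eq_0_AE sq_int_diff that x)
      then show ?thesis by simp
    qed
    ultimately show ?thesis
      using x(1) by (auto simp: unique_in_L2_def L2_on_eq_sq_int)
  qed
  ultimately show ?thesis by blast
qed

end
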